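(* Let $q,x_1,\ldots,x_n\in\mathbb{R}^d$, and suppose these points are projected onto a direction $U$ chosen uniformly at random from the unit sphere $S^{d-1}$. Then $$\mathbb{E}_U\left[\frac{1}{n}\,\#\{i:\ x_i\cdot U \text{ falls strictly between } q\cdot U \text{ and } x_{(1)}\cdot U\}\right]\ \le\ \frac12\,\Phi(q,\{x_1,\ldots,x_n\}).$$
   Context: $x_{(1)},x_{(2)},\ldots,x_{(n)}$ denotes an ordering of $x_1,\ldots,x_n$ by increasing Euclidean distance from $q$, so that $x_{(1)}$ is a nearest neighbor of $q$. The potential function is $\Phi(q,\{x_1,\ldots,x_n\})=\frac1n\sum_{i=2}^n\frac{\|q-x_{(1)}\|}{\|q-x_{(i)}\|}$. *)

theory Defs
  imports "HOL-Probability.Probability"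
begin

text \<open>
  The uniform distribution on the unit sphere is realised as the law of \<open>X / \<parallel>X\<parallel>\<close> for \<open>X\<close> uniform
  in the unit ball. It is a measure on the Borel sets of the whole space, concentrated on the
  sphere (\<open>AE_uniform_sphere\<close>) and invariant under all orthogonal transformations
  (\<open>uniform_sphere_orthogonal_invariant\<close>), which characterises it among Borel
  probability measures.
\<close>

definition uniform_sphere :: "(real ^ 'd) measure" where
  "uniform_sphere = distr (uniform_measure lborel (ball 0 1)) borel (\<lambda>x. x /\<^sub>R norm x)"

text \<open>
  \<open>s\<close> lists the indices \<open>1, \<dots>, n\<close> by increasing distance from \<open>q\<close>, so \<open>x (s i)\<close> is \<open>x\<^sub>(\<^sub>i\<^sub>)\<close>; ties
  may be broken arbitrarily.
\<close>

definition distance_ordering ::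
    "real ^ 'd \<Rightarrow> nat \<Rightarrow> (nat \<Rightarrow> real ^ 'd) \<Rightarrow> (nat \<Rightarrow> nat) \<Rightarrow> bool" where
  "distance_ordering q n x s \<longleftrightarrow>
     s permutes {1..n} \<and>
     (\<forall>i\<in>{1..n}. \<forall>j\<in>{1..n}. i \<le> j \<longrightarrow> norm (q - x (s i)) \<le> norm (q - x (s j)))"

text \<open>
  Only meant for \<open>distance_ordering q n x s\<close>; the value does not depend on the choice of such an
  \<open>s\<close> (\<open>potential_unique\<close>). A ratio with \<open>q = x (s i)\<close> is \<open>0 / 0\<close>, read as \<open>0\<close>.
\<close>

definition potential ::
    "real ^ 'd \<Rightarrow> nat \<Rightarrow> (nat \<Rightarrow> real ^ 'd) \<Rightarrow> (nat \<Rightarrow> nat) \<Rightarrow> real" where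
  "potential q n x s =
     1 / real n * (\<Sum>i = 2..n. norm (q - x (s 1)) / norm (q - x (s i)))"

definition num_between ::
    "real ^ 'd \<Rightarrow> nat \<Rightarrow> (nat \<Rightarrow> real ^ 'd) \<Rightarrow> (nat \<Rightarrow> nat) \<Rightarrow> real ^ 'd \<Rightarrow> nat" where
  "num_between q n x s u =
     card {i \<in> {1..n}. x i \<bullet> u \<in> {min (q \<bullet> u) (x (s 1) \<bullet> u) <..< max (q \<bullet> u) (x (s 1) \<bullet> u)}}"


lemma emeasure_unit_ball_neq:
  "emeasure lborel (ball (0 :: 'a::euclidean_space) 1) \<noteq> 0"
  "emeasure lborel (ball (0 :: 'a::euclidean_space) 1) \<noteq> \<infinity>"
proof -
  show "emeasure lborel (ball (0 :: 'a::euclidean_space) 1) \<noteq> \<infinity>"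
    using emeasure_lborel_ball_finite[of "0 :: 'a::euclidean_space" 1] by simp
  have "measure lebesgue (ball (0 :: 'a::euclidean_space) 1) > 0"
    using content_ball_pos[of 1 "0 :: 'a::euclidean_space"] by simp
  then show "emeasure lborel (ball (0 :: 'a::euclidean_space) 1) \<noteq> 0"
    by (auto simp: measure_def emeasure_completion)
qed

lemma sets_uniform_sphere [simp, measurable_cong]: "sets uniform_sphere = sets borel"
  and space_uniform_sphere [simp]: "space uniform_sphere = UNIV"
  by (auto simp: uniform_sphere_def)

lemma prob_space_uniform_sphere: "prob_space (uniform_sphere :: (real ^ 'd) measure)"
  unfolding uniform_sphere_def
  by (intro prob_space.prob_space_distr prob_space_uniform_measure emeasure_unit_ball_neq)
     (simp_all add: measurable_cong_sets[OF sets_uniform_measure refl])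

lemma AE_uniform_sphere: "AE u in (uniform_sphere :: (real ^ 'd) measure). u \<in> sphere 0 1"
proof -
  have "AE x in lborel. x \<noteq> (0 :: real ^ 'd)"
    by (rule AE_lborel_singleton)
  then have "AE x in lborel. x \<in> ball 0 1 \<longrightarrow> x /\<^sub>R norm x \<in> sphere (0 :: real ^ 'd) 1"
    by eventually_elim simp
  then have "AE x in uniform_measure lborel (ball 0 1). x /\<^sub>R norm x \<in> sphere (0 :: real ^ 'd) 1"
    by (intro AE_uniform_measureI) auto
  then show ?thesis
    unfolding uniform_sphere_def
    by (subst AE_distr_iff) (auto simp: measurable_cong_sets[OF sets_uniform_measure refl])
qed

lemma distr_lborel_orthogonal:
  fixes f :: "'a::euclidean_space \<Rightarrow> 'a"
  assumes f: "orthogonal_transformation f"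
  shows "distr lborel borel f = lborel"
proof (rule measure_eqI)
  fix A assume "A \<in> sets (distr lborel borel f)"
  then have A [measurable]: "A \<in> sets borel" by simp
  let ?B = "ball (0 :: 'a) 1"
  have lin: "linear f" and nrm: "norm (f v) = norm v" for v
    using f by (simp_all add: orthogonal_transformation)
  have fm [measurable]: "f \<in> borel_measurable borel"
    using lin by (intro borel_measurable_continuous_onI linear_continuous_on)
      (auto simp: linear_conv_bounded_linear[symmetric])
  have Bm [measurable]: "?B \<in> sets borel"
    by simp
  have f_inv: "f (inv f y) = y" for y
    by (rule surj_f_inv_f[OF orthogonal_transformation_surj[OF f]])
  have shift: "(\<integral>\<^sup>+v. h v \<partial>lborel) = (\<integral>\<^sup>+v. h (c + v) \<partial>lborel)"
    if h: "h \<in> borel_measurable borel" for h :: "'a \<Rightarrow> ennreal" and c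
  proof -
    have "(\<integral>\<^sup>+v. h v \<partial>lborel) = (\<integral>\<^sup>+v. h v \<partial>distr lborel borel ((+) c))"
      by (simp add: lborel_distr_plus)
    also have "\<dots> = (\<integral>\<^sup>+v. h (c + v) \<partial>lborel)"
      using h by (subst nn_integral_distr) auto
    finally show ?thesis .
  qed
  define m where "m = emeasure lborel (f -` A)"
  have fA [measurable]: "f -` A \<in> sets borel"
    using measurable_sets[OF fm A] by simp
  have m: "m = (\<integral>\<^sup>+v. indicator A (f v) \<partial>lborel)"
  proof -
    have "m = (\<integral>\<^sup>+v. indicator (f -` A) v \<partial>lborel)"
      by (simp add: m_def)
    then show ?thesis
      by (simp add: indicator_def)
  qed
  have m_shift: "m = (\<integral>\<^sup>+v. indicator A (y + f v) \<partial>lborel)" for y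
    unfolding m by (subst shift[where c = "inv f y"]) (auto simp: linear_add[OF lin] f_inv)
  have B_shift: "(\<integral>\<^sup>+v. indicator ?B (y - f v) \<partial>lborel) = emeasure lborel ?B" for y
  proof -
    have "y - f v = f (inv f y - v)" for v
      by (simp add: linear_diff[OF lin] f_inv)
    then have "(\<integral>\<^sup>+v. indicator ?B (y - f v) \<partial>lborel) = (\<integral>\<^sup>+v. indicator ?B (- inv f y + v) \<partial>lborel)"
      by (intro nn_integral_cong) (simp add: indicator_def nrm norm_minus_commute)
    also have "\<dots> = (\<integral>\<^sup>+v. indicator ?B v \<partial>lborel)"
      by (rule shift[symmetric]) (rule borel_measurable_indicator[OF Bm])
    also have "\<dots> = emeasure lborel ?B"
      by (rule nn_integral_indicator) simp
    finally show ?thesis .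
  qed
  have "emeasure lborel ?B * m = (\<integral>\<^sup>+y. indicator ?B y * m \<partial>lborel)"
    by (subst nn_integral_multc) (simp_all del: mem_ball)
  also have "\<dots> = (\<integral>\<^sup>+y. \<integral>\<^sup>+v. indicator ?B y * indicator A (y + f v) \<partial>lborel \<partial>lborel)"
  proof (rule nn_integral_cong)
    fix y
    show "indicator ?B y * m = (\<integral>\<^sup>+v. indicator ?B y * indicator A (y + f v) \<partial>lborel)"
      unfolding m_shift[of y] by (rule nn_integral_cmult[symmetric]) measurable
  qed
  also have "\<dots> = (\<integral>\<^sup>+v. \<integral>\<^sup>+y. indicator ?B y * indicator A (y + f v) \<partial>lborel \<partial>lborel)"
    by (intro lborel_pair.Fubini') measurable
  also have "\<dots> = (\<integral>\<^sup>+v. \<integral>\<^sup>+y. indicator ?B (y - f v) * indicator A y \<partial>lborel \<partial>lborel)"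
  proof (rule nn_integral_cong)
    fix v
    have "(\<integral>\<^sup>+y. indicator ?B (y - f v) * indicator A y \<partial>lborel)
        = (\<integral>\<^sup>+y. indicator ?B ((f v + y) - f v) * indicator A (f v + y) \<partial>lborel)"
      by (rule shift) measurable
    then show "(\<integral>\<^sup>+y. indicator ?B y * indicator A (y + f v) \<partial>lborel)
        = (\<integral>\<^sup>+y. indicator ?B (y - f v) * indicator A y \<partial>lborel)"
      by (simp add: add.commute del: mem_ball)
  qed
  also have "\<dots> = (\<integral>\<^sup>+y. \<integral>\<^sup>+v. indicator ?B (y - f v) * indicator A y \<partial>lborel \<partial>lborel)"
    by (intro lborel_pair.Fubini') measurable
  also have "\<dots> = (\<integral>\<^sup>+y. emeasure lborel ?B * indicator A y \<partial>lborel)"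
    by (subst nn_integral_multc) (auto simp: B_shift)
  also have "\<dots> = emeasure lborel ?B * emeasure lborel A"
    by (simp add: nn_integral_cmult)
  finally have "emeasure lborel ?B * m = emeasure lborel ?B * emeasure lborel A" .
  moreover have "emeasure lborel ?B \<noteq> 0" "emeasure lborel ?B \<noteq> \<infinity>"
    by (rule emeasure_unit_ball_neq)+
  ultimately have "m = emeasure lborel A"
    by (simp add: ennreal_mult_cancel_left)
  then show "emeasure (distr lborel borel f) A = emeasure lborel A"
    by (simp add: emeasure_distr m_def)
qed simp

lemma uniform_sphere_orthogonal_invariant:
  fixes f :: "real ^ 'd \<Rightarrow> real ^ 'd"
  assumes f: "orthogonal_transformation f"
  shows "distr uniform_sphere borel f = uniform_sphere"
proof (rule measure_eqI)
  fix A assume "A \<in> sets (distr uniform_sphere borel f)"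
  then have A [measurable]: "A \<in> sets borel" by simp
  have lin: "linear f" and nrm: "norm (f x) = norm x" for x
    using f by (simp_all add: orthogonal_transformation)
  have f_meas [measurable]: "f \<in> borel_measurable borel"
    using lin by (intro borel_measurable_continuous_onI linear_continuous_on)
      (auto simp: linear_conv_bounded_linear[symmetric])
  let ?g = "\<lambda>x :: real ^ 'd. x /\<^sub>R norm x"
  let ?U = "uniform_measure lborel (ball (0 :: real ^ 'd) 1)"
  have g_meas [measurable]: "?g \<in> borel_measurable borel" by measurable
  have g: "?g \<in> measurable ?U borel"
    by (simp add: measurable_cong_sets[OF sets_uniform_measure refl])
  have fA: "f -` A \<in> sets borel"
    using measurable_sets[OF f_meas A] by simp
  have gA: "?g -` C \<in> sets borel" if "C \<in> sets borel" for C
    using measurable_sets[OF g_meas that] by simp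
  have US: "emeasure uniform_sphere C
      = emeasure lborel (ball 0 1 \<inter> ?g -` C) / emeasure lborel (ball (0 :: real ^ 'd) 1)"
    if C: "C \<in> sets borel" for C
    unfolding uniform_sphere_def using gA[OF C] C g
    by (simp add: emeasure_distr)
  have "ball 0 1 \<inter> ?g -` (f -` A) = f -` (ball 0 1 \<inter> ?g -` A)"
    using nrm lin by (auto simp: linear_scale)
  moreover have "emeasure lborel (f -` (ball 0 1 \<inter> ?g -` A)) = emeasure lborel (ball 0 1 \<inter> ?g -` A)"
    using gA[OF A] by (subst (2) distr_lborel_orthogonal[OF f, symmetric]) (simp add: emeasure_distr)
  ultimately show "emeasure (distr uniform_sphere borel f) A = emeasure uniform_sphere A"
    using US[OF fA] US[OF A] A by (simp add: emeasure_distr)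
qed simp

lemma ex_distance_ordering: "\<exists>s. distance_ordering q n x s"
proof -
  define d where "d k = norm (q - x k)" for k
  define l where "l = sort_key d [1..<Suc n]"
  define s where "s i = (if i \<in> {1..n} then l ! (i - 1) else i)" for i
  have len: "length l = n" and set: "set l = {1..n}" and dist: "distinct l"
    by (auto simp: l_def)
  have "bij_betw (\<lambda>i. l ! (i - 1)) {1..n} {1..n}"
  proof -
    have "bij_betw (\<lambda>i. i - 1) {1..n} {..<n}"
      by (rule bij_betwI[where g = Suc]) auto
    from bij_betw_trans[OF this bij_betw_nth[OF dist _ set[symmetric], of "{..<n}"]]
    show ?thesis by (simp add: len o_def)
  qed
  then have "bij_betw s {1..n} {1..n}"
    by (rule bij_betw_cong[THEN iffD1, rotated]) (simp add: s_def)
  then have "s permutes {1..n}"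
    by (rule bij_imp_permutes) (auto simp: s_def)
  moreover have "d (s i) \<le> d (s j)" if "i \<in> {1..n}" "j \<in> {1..n}" "i \<le> j" for i j
    using sorted_nth_mono[of "map d l" "i - 1" "j - 1"] that len
    by (simp add: s_def l_def)
  ultimately show ?thesis
    by (auto simp: distance_ordering_def d_def)
qed

lemma potential_unique:
  assumes s: "distance_ordering q n x s" and t: "distance_ordering q n x t"
  shows "potential q n x s = potential q n x t"
proof -
  define d where "d k = norm (q - x k)" for k
  define L where "L p = map (\<lambda>i. d (p i)) [1..<Suc n]" for p :: "nat \<Rightarrow> nat"
  have srt: "sorted (L p)" if "distance_ordering q n x p" for p
    using that by (auto simp: L_def d_def distance_ordering_def sorted_iff_nth_mono simp del: upt_Suc)
  have ms: "mset (L p) = image_mset d (mset_set {1..n})" if "distance_ordering q n x p" for p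
  proof -
    have p: "p permutes {1..n}"
      using that by (simp add: distance_ordering_def)
    have "mset (L p) = image_mset d (image_mset p (mset_set {1..n}))"
      by (simp add: L_def image_mset.compositionality o_def atLeastLessThanSuc_atLeastAtMost
            mset_upt del: upt_Suc)
    also have "image_mset p (mset_set {1..n}) = mset_set {1..n}"
      using permutes_imp_bij[OF p] by (simp add: image_mset_mset_set bij_betw_def)
    finally show ?thesis .
  qed
  have "L s = L t"
    using srt[OF s] srt[OF t] ms[OF s] ms[OF t] by (metis properties_for_sort)
  then have eq: "d (s i) = d (t i)" if "i \<in> {1..n}" for i
    using that by (auto simp: L_def simp del: upt_Suc)
  show ?thesis
    unfolding potential_def using eq unfolding d_def by (cases "n \<le> 1") (auto intro!: sum.cong)
qed

lemma integrable_num_between: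
  "integrable (uniform_sphere :: (real ^ 'd) measure) (\<lambda>u. real (num_between q n x s u))"
proof -
  interpret prob_space "uniform_sphere :: (real ^ 'd) measure"
    by (rule prob_space_uniform_sphere)
  let ?B = "\<lambda>i. {u. x i \<bullet> u \<in> {min (q \<bullet> u) (x (s 1) \<bullet> u) <..< max (q \<bullet> u) (x (s 1) \<bullet> u)}}"
  have "(\<lambda>u. real (num_between q n x s u)) = (\<lambda>u. \<Sum>i\<in>{1..n}. indicator (?B i) u)"
  proof
    fix u
    have "real (num_between q n x s u) = (\<Sum>i\<in>{i\<in>{1..n}. u \<in> ?B i}. 1)"
      by (simp add: num_between_def)
    also have "\<dots> = (\<Sum>i\<in>{1..n}. indicator (?B i) u)"
      by (subst sum.inter_filter) (simp_all add: indicator_def of_bool_def)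
    finally show "real (num_between q n x s u) = (\<Sum>i\<in>{1..n}. indicator (?B i) u)" .
  qed
  moreover have "?B i \<in> sets borel" for i
    unfolding greaterThanLessThan_iff by measurable
  ultimately show ?thesis
    by (auto intro!: integrable_sum integrable_real_indicator simp: emeasure_eq_measure)
qed

end

theory Submission
  imports Defs
begin

text \<open>
  The probability that \<open>x\<^sub>(\<^sub>i\<^sub>) \<bullet> U\<close> lies between \<open>q \<bullet> U\<close> and \<open>x\<^sub>(\<^sub>1\<^sub>) \<bullet> U\<close> is \<open>\<theta> / \<pi>\<close>, where \<open>\<theta>\<close> is the
  angle at \<open>x\<^sub>(\<^sub>i\<^sub>)\<close> in the triangle with vertices \<open>q\<close>, \<open>x\<^sub>(\<^sub>1\<^sub>)\<close>, \<open>x\<^sub>(\<^sub>i\<^sub>)\<close>. Since \<open>x\<^sub>(\<^sub>1\<^sub>)\<close> is nearest to \<open>q\<close>,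
  \<open>\<theta>\<close> is at most a right angle, so \<open>\<theta> / \<pi> \<le> sin \<theta> / 2\<close>, and the law of sines bounds \<open>sin \<theta>\<close> by
  the ratio of distances. The measure of a wedge is bounded without integration: by rotation
  invariance it is additive in the angle, and it is at most a half.
\<close>

section \<open>A lower bound for the sine, and invariance of the sphere measure\<close>

text \<open>Jordan's inequality: the sine is concave on \<open>{0..pi}\<close>, hence lies above its
  chord from \<open>0\<close> to \<open>pi / 2\<close>.\<close>

lemma sin_ge_linear:
  fixes t :: real
  assumes "0 \<le> t" "t \<le> pi / 2"
  shows "2 / pi * t \<le> sin t"
proof -
  have "concave_on {0..pi} sin"
    unfolding concave_on_def
    by (rule f''_ge0_imp_convex[where f' = "\<lambda>x. - cos x" and f'' = sin])
       (auto intro!: derivative_eq_intros sin_ge_zero)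
  then have "convex_on {0..pi} (\<lambda>x. - sin x)"
    by (simp add: concave_on_def)
  from convex_onD[OF this, of "2 / pi * t" 0 "pi / 2"] assms
  show ?thesis by (simp add: field_simps)
qed

lemma measure_uniform_sphere_vimage:
  fixes f :: "real ^ 'd \<Rightarrow> real ^ 'd"
  assumes f: "orthogonal_transformation f" and A: "A \<in> sets borel"
  shows "measure uniform_sphere (f -` A) = measure uniform_sphere A"
proof -
  have "f \<in> borel_measurable borel"
    using f by (intro borel_measurable_continuous_onI linear_continuous_on)
      (auto simp: linear_conv_bounded_linear[symmetric] orthogonal_transformation)
  then have "f \<in> measurable uniform_sphere borel"
    by (simp add: measurable_cong_sets[OF sets_uniform_sphere refl])
  from measure_distr[OF this A] show ?thesis
    by (simp add: uniform_sphere_orthogonal_invariant[OF f])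
qed

section \<open>Wedges and rotations of a plane\<close>

text \<open>Strict on one side and weak on the other, so that consecutive wedges are disjoint and
  fit together exactly, with no null set to discard.\<close>

definition wedge :: "'a::real_inner \<Rightarrow> 'a \<Rightarrow> 'a set" where
  "wedge v w = {u. v \<bullet> u > 0 \<and> w \<bullet> u \<le> 0}"

lemma wedge_self [simp]: "wedge v v = {}"
  by (auto simp: wedge_def)

lemma wedge_borel [measurable]: "wedge v (w :: 'a::euclidean_space) \<in> sets borel"
  unfolding wedge_def by measurable

definition planar :: "'a::real_vector \<Rightarrow> 'a \<Rightarrow> real \<Rightarrow> 'a" where
  "planar p r t = cos t *\<^sub>R p + sin t *\<^sub>R r"

text \<open>For orthonormal \<open>p\<close> and \<open>r\<close>, the rotation by \<open>s\<close>
  in their plane that fixes the orthogonal complement. Writing it as a correction to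
  \<open>v\<close> avoids completing \<open>p\<close>, \<open>r\<close> to a basis.\<close>

definition planar_rotation :: "'a::real_inner \<Rightarrow> 'a \<Rightarrow> real \<Rightarrow> 'a \<Rightarrow> 'a" where
  "planar_rotation p r s v = v
     + ((cos s - 1) * (v \<bullet> p) - sin s * (v \<bullet> r)) *\<^sub>R p
     + (sin s * (v \<bullet> p) + (cos s - 1) * (v \<bullet> r)) *\<^sub>R r"

locale orthonormal_pair =
  fixes p r :: "real ^ 'd"
  assumes pp: "p \<bullet> p = 1" and rr: "r \<bullet> r = 1" and pr: "p \<bullet> r = 0"
begin

lemma rp: "r \<bullet> p = 0"
  using pr by (simp add: inner_commute)

lemma orthogonal_transformation_planar_rotation:
  "orthogonal_transformation (planar_rotation p r s)"
  unfolding orthogonal_transformation_def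
proof (intro conjI allI)
  show "linear (planar_rotation p r s)"
    by (rule linearI) (simp_all add: planar_rotation_def inner_simps algebra_simps)
next
  fix v w
  define c d where "c = cos s" and "d = sin s"
  have cd: "d * d = 1 - c * c"
    using sin_cos_squared_add[of s] by (simp add: c_def d_def power2_eq_square algebra_simps)
  define a b a' b' where "a = v \<bullet> p" and "b = v \<bullet> r" and "a' = w \<bullet> p" and "b' = w \<bullet> r"
  have "planar_rotation p r s v \<bullet> planar_rotation p r s w = v \<bullet> w
      + ((c-1) * a' - d * b') * a + (d * a' + (c-1) * b') * b
      + ((c-1) * a - d * b) * a' + (d * a + (c-1) * b) * b'
      + ((c-1) * a - d * b) * ((c-1) * a' - d * b') + (d * a + (c-1) * b) * (d * a' + (c-1) * b')"
    unfolding planar_rotation_def c_def[symmetric] d_def[symmetric]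
    by (simp add: inner_simps pp rr pr rp a_def b_def a'_def b'_def inner_commute[of p v]
        inner_commute[of p w] inner_commute[of r v] inner_commute[of r w] algebra_simps)
  also have "\<dots> = v \<bullet> w + (c * c + d * d - 1) * (a * a' + b * b')"
    by (simp add: algebra_simps)
  also have "\<dots> = v \<bullet> w"
    by (simp add: cd)
  finally show "planar_rotation p r s v \<bullet> planar_rotation p r s w = v \<bullet> w" .
qed

lemma planar_inner_rotation:
  "planar p r (s + t) \<bullet> planar_rotation p r s u = planar p r t \<bullet> u"
proof -
  have *: "p \<bullet> planar_rotation p r s u = cos s * (p \<bullet> u) - sin s * (r \<bullet> u)"
    "r \<bullet> planar_rotation p r s u = sin s * (p \<bullet> u) + cos s * (r \<bullet> u)"
    by (simp_all add: planar_rotation_def inner_simps pp rr pr rp inner_commute[of u] algebra_simps)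
  \<comment> \<open>The factor equal to one is kept, so that both sides expand to the same
    polynomial.\<close>
  have "planar p r (s + t) \<bullet> planar_rotation p r s u
      = (cos s * cos s + sin s * sin s) * (cos t * (p \<bullet> u) + sin t * (r \<bullet> u))"
    by (simp add: planar_def inner_simps * cos_add sin_add algebra_simps del: sin_cos_squared_add3)
  then show ?thesis
    by (simp add: planar_def inner_simps)
qed

lemma measure_wedge_rotate:
  "measure uniform_sphere (wedge (planar p r s) (planar p r (s + t)))
    = measure uniform_sphere (wedge (planar p r 0) (planar p r t))"
proof -
  have "planar_rotation p r s -` wedge (planar p r s) (planar p r (s + t))
      = wedge (planar p r 0) (planar p r t)"
    using planar_inner_rotation[of s 0] planar_inner_rotation[of s t] by (auto simp: wedge_def)
  then show ?thesis
    using measure_uniform_sphere_vimage[OF orthogonal_transformation_planar_rotation wedge_borel]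
    by metis
qed

text \<open>For \<open>s\<close> and \<open>t\<close> nonnegative with \<open>s + t < pi\<close> no
  coefficient is negative, so the middle direction lies in the cone of the outer two. This is what
  lets a wedge be cut in two.\<close>

lemma planar_inner_identity:
  "sin s * (planar p r (s + t) \<bullet> u) + sin t * (planar p r 0 \<bullet> u)
    = sin (s + t) * (planar p r s \<bullet> u)"
proof -
  have "sin s * (planar p r (s + t) \<bullet> u) + sin t * (planar p r 0 \<bullet> u) - sin (s + t) * (planar p r s \<bullet> u)
      = sin t * (p \<bullet> u) * (1 - (cos s * cos s + sin s * sin s))"
    by (simp add: planar_def inner_simps cos_add sin_add algebra_simps del: sin_cos_squared_add3)
  then show ?thesis
    by simp
qed

lemma wedge_split:
  assumes "0 \<le> s" "0 \<le> t" "s + t < pi"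
  shows "wedge (planar p r 0) (planar p r (s + t))
    = wedge (planar p r 0) (planar p r s) \<union> wedge (planar p r s) (planar p r (s + t))"
proof -
  have *: "planar p r (s + t) \<bullet> u \<le> 0" if "planar p r 0 \<bullet> u > 0" "planar p r s \<bullet> u \<le> 0" for u
  proof -
    \<comment> \<open>For \<open>s = 0\<close> the two sign conditions on \<open>u\<close>
      contradict each other.\<close>
    have "s > 0"
      using that assms by (cases "s = 0") auto
    then have s: "sin s > 0" and "sin t \<ge> 0" "sin (s + t) \<ge> 0"
      using assms by (auto intro!: sin_gt_zero sin_ge_zero)
    then have "0 \<le> sin t * (planar p r 0 \<bullet> u)" "sin (s + t) * (planar p r s \<bullet> u) \<le> 0"
      using that by (auto intro: mult_nonneg_nonpos)
    then have "sin s * (planar p r (s + t) \<bullet> u) \<le> 0"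
      using planar_inner_identity[of s t u] by linarith
    with s show ?thesis
      by (simp add: mult_le_0_iff)
  qed
  have **: "planar p r 0 \<bullet> u > 0" if "planar p r s \<bullet> u > 0" "planar p r (s + t) \<bullet> u \<le> 0" for u
  proof -
    have "t > 0"
      using that assms by (cases "t = 0") auto
    then have s: "sin t > 0" "sin s \<ge> 0" "sin (s + t) > 0"
      using assms by (auto intro!: sin_gt_zero sin_ge_zero)
    then have "0 < sin (s + t) * (planar p r s \<bullet> u)" "sin s * (planar p r (s + t) \<bullet> u) \<le> 0"
      using that by (auto intro: mult_nonneg_nonpos)
    then have "sin t * (planar p r 0 \<bullet> u) > 0"
      using planar_inner_identity[of s t u] by linarith
    with s show ?thesis
      by (simp add: zero_less_mult_iff)
  qed
  show ?thesis
    using * ** by (force simp: wedge_def)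
qed

section \<open>The measure of a wedge as a function of its angle\<close>

abbreviation "wedge_measure t \<equiv> measure uniform_sphere (wedge (planar p r 0) (planar p r t))"

lemma wedge_measure_add:
  assumes "0 \<le> s" "0 \<le> t" "s + t < pi"
  shows "wedge_measure (s + t) = wedge_measure s + wedge_measure t"
proof -
  interpret prob_space "uniform_sphere :: (real ^ 'd) measure"
    by (rule prob_space_uniform_sphere)
  have "wedge_measure (s + t) = wedge_measure s
      + measure uniform_sphere (wedge (planar p r s) (planar p r (s + t)))"
    unfolding wedge_split[OF assms] by (rule finite_measure_Union) (auto simp: wedge_def)
  then show ?thesis
    by (simp add: measure_wedge_rotate)
qed

lemma wedge_measure_mult:
  assumes "0 \<le> t" "real k * t < pi"
  shows "wedge_measure (real k * t) = real k * wedge_measure t"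
  using assms(2)
proof (induction k)
  case 0
  then show ?case by simp
next
  case (Suc k)
  have "real k * t + t < pi"
    using Suc.prems by (simp add: algebra_simps)
  moreover from this have "real k * t < pi"
    using assms by linarith
  ultimately show ?case
    using wedge_measure_add[of "real k * t" t] assms Suc.IH by (simp add: algebra_simps)
qed

text \<open>The antipodal image of a wedge is disjoint from it and has the same measure.\<close>

lemma wedge_measure_le_half: "wedge_measure t \<le> 1 / 2"
proof -
  interpret prob_space "uniform_sphere :: (real ^ 'd) measure"
    by (rule prob_space_uniform_sphere)
  let ?W = "wedge (planar p r 0) (planar p r t)"
  have "orthogonal_transformation (\<lambda>v :: real ^ 'd. - v)"
    by (simp add: orthogonal_transformation_neg orthogonal_transformation_id)
  then have "prob (uminus -` ?W) = prob ?W"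
    by (rule measure_uniform_sphere_vimage) simp
  moreover have "uminus -` ?W \<in> events"
    unfolding wedge_def vimage_def by simp
  then have "prob (?W \<union> uminus -` ?W) = prob ?W + prob (uminus -` ?W)"
    by (intro finite_measure_Union) (auto simp: wedge_def)
  moreover have "prob (?W \<union> uminus -` ?W) \<le> 1"
    by simp
  ultimately show ?thesis
    by linarith
qed

text \<open>
  For \<open>m\<close> maximal with \<open>m t / k < \<pi>\<close>, additivity gives \<open>m / k\<close> times the measure as that of a single
  wedge, hence at most a half; then let \<open>k\<close> tend to infinity.
\<close>

lemma wedge_measure_le:
  assumes "0 \<le> t" "t < pi"
  shows "wedge_measure t \<le> t / (2 * pi)"
proof (cases "t = 0")
  case True
  then show ?thesis by simp
next
  case False
  with assms have t: "t > 0" by simp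
  let ?f = "wedge_measure t"
  have f: "0 \<le> ?f" "?f \<le> 1/2"
    using wedge_measure_le_half by auto
  have "?f * (pi / t) - 1 / 2 \<le> 1 / real (Suc k)" for k
  proof -
    define K where "K = real (Suc k)"
    have K: "K > 0" by (simp add: K_def)
    define h where "h = t / K"
    have h: "h > 0" using t K by (simp add: h_def)
    have fh: "?f = K * wedge_measure h"
      using wedge_measure_mult[of h "Suc k"] assms h K by (simp add: h_def flip: K_def del: of_nat_Suc)
    \<comment> \<open>Ceiling minus one rather than floor: \<open>m * h\<close> must stay strictly
      below \<open>pi\<close> even when \<open>pi / h\<close> is an integer.\<close>
    define m where "m = nat (\<lceil>pi / h\<rceil> - 1)"
    have "\<lceil>pi / h\<rceil> \<ge> 1"
      using h by (simp add: one_le_ceiling)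
    then have m: "real m = real_of_int \<lceil>pi / h\<rceil> - 1"
      by (simp add: m_def)
    then have "real m < pi / h" "pi / h \<le> real m + 1"
      by linarith+
    then have mh: "real m * h < pi" and m_ge: "pi / h - 1 \<le> real m"
      using h by (auto simp: field_simps)
    have "(pi / h - 1) * wedge_measure h \<le> real m * wedge_measure h"
      using m_ge by (intro mult_right_mono) auto
    also have "\<dots> = wedge_measure (real m * h)"
      using wedge_measure_mult[of h m] h mh by simp
    also have "\<dots> \<le> 1 / 2"
      by (rule wedge_measure_le_half)
    finally have "pi / h * wedge_measure h - wedge_measure h \<le> 1 / 2"
      by (simp add: algebra_simps)
    moreover have "pi / h * wedge_measure h = ?f * (pi / t)"
      using K t by (simp add: fh h_def)
    \<comment> \<open>The error from rounding \<open>pi / h\<close> down costs at most one small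
      wedge.\<close>
    moreover have "wedge_measure h \<le> 1 / K"
      using f K by (simp add: fh field_simps)
    ultimately have "?f * (pi / t) - 1 / 2 \<le> 1 / K"
      by linarith
    then show ?thesis
      by (simp only: K_def)
  qed
  then have "?f * (pi / t) - 1 / 2 \<le> 0"
    by (metis nat_approx_posE not_le order.strict_trans2 order_less_irrefl)
  then show ?thesis
    using t by (simp add: field_simps)
qed

end

section \<open>From pairs of vectors to angles\<close>

text \<open>Gram-Schmidt applied to \<open>b\<close> and \<open>c\<close>. The sign of
  \<open>b \<bullet> c\<close> puts the angle in the first quadrant, and linear independence makes
  it positive.\<close>

lemma ex_planar:
  fixes b c :: "real ^ 'd"
  assumes "b \<noteq> 0" "\<And>l. c \<noteq> l *\<^sub>R b" "b \<bullet> c \<ge> 0"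
  obtains p r t where "orthonormal_pair p r" "b = norm b *\<^sub>R planar p r 0" "0 < t" "t \<le> pi / 2"
    "c = norm c *\<^sub>R planar p r t"
proof -
  define p where "p = b /\<^sub>R norm b"
  define e where "e = c - (c \<bullet> p) *\<^sub>R p"
  define r where "r = e /\<^sub>R norm e"
  have b: "b = norm b *\<^sub>R p" and pp: "p \<bullet> p = 1"
    using assms(1) by (simp_all add: p_def dot_square_norm power2_eq_square)
  have "e \<noteq> 0"
    using assms(2)[of "(c \<bullet> p) / norm b"] by (auto simp: e_def p_def divide_inverse)
  have pe: "p \<bullet> e = 0"
    by (simp add: e_def inner_simps pp inner_commute)
  have on: "orthonormal_pair p r"
    using pp pe \<open>e \<noteq> 0\<close> by unfold_locales (simp_all add: r_def dot_square_norm power2_eq_square)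
  have c: "c = (c \<bullet> p) *\<^sub>R p + norm e *\<^sub>R r"
    using \<open>e \<noteq> 0\<close> by (simp add: r_def e_def)
  have "c \<noteq> 0"
    using assms(2)[of 0] by simp
  have "(c \<bullet> p / norm c)\<^sup>2 + (norm e / norm c)\<^sup>2 = ((c \<bullet> p)\<^sup>2 + (norm e)\<^sup>2) / (norm c)\<^sup>2"
    by (simp add: power_divide add_divide_distrib)
  also have "(c \<bullet> p)\<^sup>2 + (norm e)\<^sup>2 = c \<bullet> c"
    using on by (subst (2 3) c)
      (simp add: inner_simps orthonormal_pair_def inner_commute power2_eq_square)
  also have "\<dots> / (norm c)\<^sup>2 = 1"
    using \<open>c \<noteq> 0\<close> by (simp add: dot_square_norm)
  finally have "(c \<bullet> p / norm c)\<^sup>2 + (norm e / norm c)\<^sup>2 = 1" .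
  moreover have cp: "c \<bullet> p / norm c \<ge> 0" and ce: "norm e / norm c > 0"
    using assms(3) \<open>e \<noteq> 0\<close> \<open>c \<noteq> 0\<close> by (simp_all add: p_def inner_commute)
  ultimately obtain t where t: "0 \<le> t" "t \<le> pi / 2" "c \<bullet> p / norm c = cos t" "norm e / norm c = sin t"
    using sincos_total_pi_half[of "c \<bullet> p / norm c" "norm e / norm c"] by (metis less_imp_le)
  have "t \<noteq> 0"
    using t ce by auto
  have "norm c *\<^sub>R planar p r t = (c \<bullet> p) *\<^sub>R p + norm e *\<^sub>R r"
    using \<open>c \<noteq> 0\<close> by (simp add: planar_def scaleR_add_right flip: t(3,4))
  then have "c = norm c *\<^sub>R planar p r t"
    using c by metis
  with on b t \<open>t \<noteq> 0\<close> show thesis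
    by (intro that[of p r t]) (auto simp: planar_def)
qed

text \<open>With \<open>q\<close> moved to the origin, \<open>a\<close> and \<open>b\<close> play
  the roles of the nearest and another point. For \<open>c = b - a\<close> the event reads
  \<open>b \<bullet> u > 0\<close> and \<open>c \<bullet> u < 0\<close>; outside the degenerate
  cases it lies in a wedge whose angle is the one at \<open>b\<close> in the triangle
  \<open>0\<close>, \<open>a\<close>, \<open>b\<close>.\<close>

lemma measure_half_between_le:
  fixes a b :: "real ^ 'd"
  assumes ab: "norm a \<le> norm b"
  shows "measure uniform_sphere {u. 0 < b \<bullet> u \<and> b \<bullet> u < a \<bullet> u} \<le> 1 / 4 * (norm a / norm b)"
    (is "measure _ ?E \<le> _")
proof -
  interpret prob_space "uniform_sphere :: (real ^ 'd) measure"
    by (rule prob_space_uniform_sphere)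
  define c where "c = b - a"
  have "a \<bullet> b \<le> norm b * norm b"
    using norm_cauchy_schwarz[of a b] mult_right_mono[OF ab, of "norm b"] by simp
  then have bc: "b \<bullet> c \<ge> 0"
    by (simp add: c_def inner_simps inner_commute dot_square_norm power2_eq_square)
  show ?thesis
  \<comment> \<open>If \<open>b\<close> is nonzero and \<open>c\<close> is parallel to it, then
    \<open>b \<bullet> c \<ge> 0\<close> makes \<open>c\<close> a nonnegative multiple of
    \<open>b\<close>, so the event is empty. It is also empty for \<open>b = 0\<close>, where the
    ratio reads as \<open>0\<close>.\<close>
  proof (cases "b = 0 \<or> (\<exists>l. c = l *\<^sub>R b)")
    case True
    have "?E = {}"
    proof (rule ccontr)
      assume "?E \<noteq> {}"
      then obtain u where u: "0 < b \<bullet> u" "c \<bullet> u < 0"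
        by (auto simp: c_def inner_simps)
      then have "b \<noteq> 0"
        by auto
      with True obtain l where l: "c = l *\<^sub>R b" "b \<noteq> 0"
        by auto
      then have "b \<bullet> b > 0"
        by simp
      with bc l have "l \<ge> 0"
        by (simp add: zero_le_mult_iff del: inner_gt_zero_iff)
      with u l show False
        by (auto simp: mult_less_0_iff)
    qed
    then have "prob ?E = 0"
      by (simp only: measure_empty)
    then show ?thesis by simp
  next
    case False
    then obtain p r t where on: "orthonormal_pair p r" and b: "b = norm b *\<^sub>R planar p r 0"
      and t: "0 < t" "t \<le> pi / 2" and c: "c = norm c *\<^sub>R planar p r t"
      using ex_planar[of b c] bc by metis
    interpret orthonormal_pair p r by fact
    have pos: "norm b > 0" "norm c > 0"
      using False by auto
    have "?E \<subseteq> wedge (planar p r 0) (planar p r t)"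
    proof
      fix u assume "u \<in> ?E"
      then have "0 < (norm b *\<^sub>R planar p r 0) \<bullet> u" "(norm c *\<^sub>R planar p r t) \<bullet> u < 0"
        unfolding b[symmetric] c[symmetric] by (auto simp: c_def inner_simps)
      then show "u \<in> wedge (planar p r 0) (planar p r t)"
        using pos by (auto simp: wedge_def mult_less_0_iff zero_less_mult_iff)
    qed
    then have "prob ?E \<le> wedge_measure t"
      by (intro finite_measure_mono) auto
    also have "\<dots> \<le> t / (2 * pi)"
      using t by (intro wedge_measure_le) (auto intro: le_less_trans)
    also have "\<dots> \<le> sin t / 4"
      using sin_ge_linear[of t] t by (simp add: field_simps)
    also have "sin t \<le> norm a / norm b"
    proof -
      \<comment> \<open>A unit vector orthogonal to \<open>c\<close>: hence \<open>a\<close> and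
        \<open>b\<close> have the same inner product with it, namely
        \<open>- (norm b * sin t)\<close>, and Cauchy-Schwarz gives the part of the law of sines
        that is used.\<close>
      define z where "z = planar p r (t + pi / 2)"
      have "z \<bullet> z = cos t * cos t + sin t * sin t"
        by (simp add: z_def planar_def inner_simps pp rr pr rp cos_add sin_add)
      then have "norm z = 1"
        by (simp add: norm_eq_1 flip: power2_eq_square)
      have "a = norm b *\<^sub>R planar p r 0 - norm c *\<^sub>R planar p r t"
        using b c c_def by (metis add_diff_cancel_left' diff_add_cancel)
      then have "a \<bullet> z = (norm b *\<^sub>R planar p r 0 - norm c *\<^sub>R planar p r t) \<bullet> z"
        by metis
      also have "\<dots> = - (norm b * sin t)"
        by (simp add: z_def planar_def inner_simps pp rr pr rp cos_add sin_add algebra_simps)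
      finally have "norm b * sin t \<le> norm a"
        using Cauchy_Schwarz_ineq2[of a z] \<open>norm z = 1\<close> by simp
      then show ?thesis
        using pos by (simp add: field_simps)
    qed
    finally show ?thesis by simp
  qed
qed

text \<open>The sign of \<open>a \<bullet> u\<close> splits the event into two halves; the negative
  half is the positive one for \<open>- a\<close> and \<open>- b\<close>.\<close>

lemma measure_between_le:
  fixes a b :: "real ^ 'd"
  assumes "norm a \<le> norm b"
  shows "measure uniform_sphere {u. b \<bullet> u \<in> {min 0 (a \<bullet> u) <..< max 0 (a \<bullet> u)}}
    \<le> 1 / 2 * (norm a / norm b)"
proof -
  interpret prob_space "uniform_sphere :: (real ^ 'd) measure"
    by (rule prob_space_uniform_sphere)
  let ?E = "\<lambda>a b. {u. 0 < b \<bullet> u \<and> b \<bullet> u < a \<bullet> u} :: (real ^ 'd) set"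
  have E: "?E a b \<in> events" for a b
    by simp
  have "{u. b \<bullet> u \<in> {min 0 (a \<bullet> u) <..< max 0 (a \<bullet> u)}} \<subseteq> ?E a b \<union> ?E (- a) (- b)"
    by auto
  then have "prob {u. b \<bullet> u \<in> {min 0 (a \<bullet> u) <..< max 0 (a \<bullet> u)}} \<le> prob (?E a b \<union> ?E (- a) (- b))"
    by (intro finite_measure_mono sets.Un E)
  also have "\<dots> \<le> prob (?E a b) + prob (?E (- a) (- b))"
    by (intro measure_Un_le E)
  also have "\<dots> \<le> 1 / 2 * (norm a / norm b)"
    using measure_half_between_le[OF assms] measure_half_between_le[of "- a" "- b"] assms by simp
  finally show ?thesis .
qed

section \<open>Summation over the points\<close>

theorem theorem3:
  fixes q :: "real ^ 'd" and x :: "nat \<Rightarrow> real ^ 'd" and n :: nat and s :: "nat \<Rightarrow> nat"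
  assumes "n \<ge> 1"
    and "distance_ordering q n x s"
  shows "(\<integral>u. 1 / real n * real (num_between q n x s u) \<partial>uniform_sphere)
           \<le> 1 / 2 * potential q n x s"
proof -
  interpret prob_space "uniform_sphere :: (real ^ 'd) measure"
    by (rule prob_space_uniform_sphere)
  define B where "B i = {u. x i \<bullet> u \<in> {min (q \<bullet> u) (x (s 1) \<bullet> u) <..< max (q \<bullet> u) (x (s 1) \<bullet> u)}}" for i
  have perm: "s permutes {1..n}"
    and ord: "i \<in> {1..n} \<Longrightarrow> norm (q - x (s 1)) \<le> norm (q - x (s i))" for i
    using assms by (auto simp: distance_ordering_def)
  have B_sets: "B i \<in> events" for i
    unfolding B_def greaterThanLessThan_iff by simp
  have "real (num_between q n x s u) = (\<Sum>i\<in>{1..n}. indicator (B i) u)" for u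
  proof -
    have "real (num_between q n x s u) = (\<Sum>i\<in>{i\<in>{1..n}. u \<in> B i}. 1)"
      by (simp add: num_between_def B_def)
    then show ?thesis
      by (subst (asm) sum.inter_filter) (simp_all add: indicator_def of_bool_def)
  qed
  then have "(\<integral>u. real (num_between q n x s u) \<partial>uniform_sphere) = (\<Sum>i\<in>{1..n}. prob (B i))"
    using B_sets by (simp add: emeasure_eq_measure integrable_real_indicator)
  \<comment> \<open>Reindexing by \<open>s\<close> lists the points by distance, to match
    \<open>potential\<close>.\<close>
  also have "\<dots> = (\<Sum>i\<in>{1..n}. prob (B (s i)))"
    using sum.permute[OF perm, of "\<lambda>i. prob (B i)"] by (simp add: o_def)
  also have "\<dots> = prob (B (s 1)) + (\<Sum>i = 2..n. prob (B (s i)))"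
    using assms(1) by (simp add: sum.atLeast_Suc_atMost numeral_2_eq_2)
  \<comment> \<open>The nearest point projects to an endpoint of the open interval, which is why the
    sum starts at \<open>2\<close>.\<close>
  also have "B (s 1) = {}"
    by (auto simp: B_def)
  also have "(\<Sum>i = 2..n. prob (B (s i)))
      \<le> (\<Sum>i = 2..n. 1 / 2 * (norm (q - x (s 1)) / norm (q - x (s i))))"
  proof (rule sum_mono)
    fix i assume "i \<in> {2..n}"
    then have "norm (x (s 1) - q) \<le> norm (x (s i) - q)"
      using ord[of i] by (simp add: norm_minus_commute)
    moreover have "B (s i) = {u. (x (s i) - q) \<bullet> u
        \<in> {min 0 ((x (s 1) - q) \<bullet> u) <..< max 0 ((x (s 1) - q) \<bullet> u)}}"
      by (auto simp: B_def inner_simps)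
    ultimately show "prob (B (s i)) \<le> 1 / 2 * (norm (q - x (s 1)) / norm (q - x (s i)))"
      using measure_between_le[of "x (s 1) - q" "x (s i) - q"] by (simp add: norm_minus_commute)
  qed
  finally have "(\<integral>u. real (num_between q n x s u) \<partial>uniform_sphere)
      \<le> 1 / 2 * (\<Sum>i = 2..n. norm (q - x (s 1)) / norm (q - x (s i)))"
    by (simp add: sum_distrib_left)
  from mult_left_mono[OF this, of "1 / real n"] show ?thesis
    by (simp add: potential_def)
qed

end
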